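(* Let $f:(\mathbb{R}^3,0)\to(\mathbb{R}^2,0)$ be a $C^\infty$ map-germ which is a definite fold at $0$, let $D_1$ be a rank $2$ tangent distribution on a neighborhood of $0$ in $\mathbb{R}^3$, and let $\varphi:D_1\to f^*T\mathbb{R}^2$, $\varphi(v)=df(v)$, be the bundle homomorphism induced by $f$. If $\operatorname{rank}\varphi_0=1$, then $0$ is a fold-like singular point of $\varphi$.
   Context: Two map-germs $f,g:(\mathbb{R}^m,0)\to(\mathbb{R}^n,0)$ are $\mathcal{A}$-equivalent if there exist diffeomorphism-germs $\sigma$ of $(\mathbb{R}^m,0)$ and $\tau$ of $(\mathbb{R}^n,0)$ with $\tau\circ f\circ\sigma^{-1}=g$. The germ $f$ is a definite fold at $0$ if it is $\mathcal{A}$-equivalent to $(u,v,w)\mapsto(u,v^2+w^2)$ at $0$. For a frame $\{e_1,e_2\}$ of $D_1$, put $\lambda_\varphi=\det(e_1f,e_2f)$; the singular set of $\varphi$ (points where $\operatorname{rank}\varphi_p<2$) is $S=\{\lambda_\varphi=0\}$. A singular point is of corank one if $\operatorname{rank}\varphi_p=1$. A null section of $\varphi$ near a corank one singular point $p$ is a smooth section $\eta_\varphi$ of $D_1$ on a neighborhood $U$ of $p$ such that $(\eta_\varphi)_q$ generates $\ker\varphi_q$ for all $q\in S\cap U$. A singular point $p$ is fold-like if it is of corank one and $\eta_\varphi\lambda_\varphi(p)\ne0$ (directional derivative); this does not depend on the choice of frame and null section. *)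

theory Defs
  imports "HOL-Analysis.Analysis"
begin

section \<open>Smooth maps\<close>

text \<open>
  On a finite-dimensional domain, \<open>f\<close> is of class \<open>C\<^sup>k\<^sup>+\<^sup>1\<close> on an open set iff it is
  differentiable there and every directional derivative is of class \<open>C\<^sup>k\<close>. The predicate is
  only meant for open \<open>U\<close>.
\<close>

primrec Ck_on :: "nat \<Rightarrow> 'a set \<Rightarrow> ('a::euclidean_space \<Rightarrow> 'b::euclidean_space) \<Rightarrow> bool" where
  "Ck_on 0 U f \<longleftrightarrow> continuous_on U f"
| "Ck_on (Suc k) U f \<longleftrightarrow>
     (\<forall>x\<in>U. f differentiable (at x)) \<and> (\<forall>v. Ck_on k U (\<lambda>x. frechet_derivative f (at x) v))"

definition smooth_on :: "'a set \<Rightarrow> ('a::euclidean_space \<Rightarrow> 'b::euclidean_space) \<Rightarrow> bool" where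
  "smooth_on U f \<longleftrightarrow> (\<forall>k. Ck_on k U f)"

section \<open>Map-germs at the origin\<close>

text \<open>
  A germ is given by a representative; only its values near \<open>0\<close> matter, and equality of
  germs is equality eventually in \<open>nhds 0\<close>.
\<close>

definition smooth_map_germ :: "('a::euclidean_space \<Rightarrow> 'b::euclidean_space) \<Rightarrow> bool" where
  "smooth_map_germ f \<longleftrightarrow> f 0 = 0 \<and> (\<exists>U. open U \<and> 0 \<in> U \<and> smooth_on U f)"

definition inverse_diffeo_germs ::
    "('a::euclidean_space \<Rightarrow> 'a) \<Rightarrow> ('a \<Rightarrow> 'a) \<Rightarrow> bool" where
  "inverse_diffeo_germs \<sigma> \<sigma>' \<longleftrightarrow>
     smooth_map_germ \<sigma> \<and> smooth_map_germ \<sigma>' \<and>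
     (\<forall>\<^sub>F x in nhds 0. \<sigma>' (\<sigma> x) = x) \<and> (\<forall>\<^sub>F y in nhds 0. \<sigma> (\<sigma>' y) = y)"

definition diffeo_germ :: "('a::euclidean_space \<Rightarrow> 'a) \<Rightarrow> bool" where
  "diffeo_germ \<tau> \<longleftrightarrow> (\<exists>\<tau>'. inverse_diffeo_germs \<tau> \<tau>')"

definition A_equivalent ::
    "(real^'m \<Rightarrow> real^'n) \<Rightarrow> (real^'m \<Rightarrow> real^'n) \<Rightarrow> bool" where
  "A_equivalent f g \<longleftrightarrow>
     (\<exists>\<sigma> \<sigma>' \<tau>. inverse_diffeo_germs \<sigma> \<sigma>' \<and> diffeo_germ \<tau> \<and>
        (\<forall>\<^sub>F x in nhds 0. \<tau> (f (\<sigma>' x)) = g x))"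

definition definite_fold_model :: "real^3 \<Rightarrow> real^2" where
  "definite_fold_model x = vector [x $ 1, (x $ 2)\<^sup>2 + (x $ 3)\<^sup>2]"

definition definite_fold :: "(real^3 \<Rightarrow> real^2) \<Rightarrow> bool" where
  "definite_fold f \<longleftrightarrow> A_equivalent f definite_fold_model"

section \<open>Rank two distributions and bundle homomorphisms\<close>

text \<open>
  Every tangent space of \<open>\<real>\<^sup>3\<close> is identified with \<open>\<real>\<^sup>3\<close>, so a distribution \<open>D\<close> on \<open>W\<close> assigns
  to \<open>p \<in> W\<close> a plane \<open>D p\<close>. In the same way \<open>f\<^sup>*T\<real>\<^sup>2\<close> is trivial with fibre \<open>\<real>\<^sup>2\<close>, so a
  homomorphism \<open>\<phi>\<close> from \<open>D\<close> to it is a family of maps \<open>\<phi> p\<close>, of which only the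
  restriction to \<open>D p\<close>, for \<open>p \<in> W\<close>, is used.
\<close>

definition frame_on ::
    "(real^3) set \<Rightarrow> (real^3 \<Rightarrow> (real^3) set) \<Rightarrow> (real^3 \<Rightarrow> real^3) \<Rightarrow> (real^3 \<Rightarrow> real^3) \<Rightarrow> bool" where
  "frame_on V D e1 e2 \<longleftrightarrow>
     smooth_on V e1 \<and> smooth_on V e2 \<and>
     (\<forall>q\<in>V. e1 q \<noteq> e2 q \<and> independent {e1 q, e2 q} \<and> span {e1 q, e2 q} = D q)"

definition rank2_distribution_on ::
    "(real^3) set \<Rightarrow> (real^3 \<Rightarrow> (real^3) set) \<Rightarrow> bool" where
  "rank2_distribution_on W D \<longleftrightarrow>
     (\<forall>p\<in>W. \<exists>V e1 e2. open V \<and> p \<in> V \<and> V \<subseteq> W \<and> frame_on V D e1 e2)"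

definition hom_rank ::
    "(real^3 \<Rightarrow> (real^3) set) \<Rightarrow> (real^3 \<Rightarrow> real^3 \<Rightarrow> real^2) \<Rightarrow> real^3 \<Rightarrow> nat" where
  "hom_rank D \<phi> p = dim (\<phi> p ` D p)"

definition hom_kernel ::
    "(real^3 \<Rightarrow> (real^3) set) \<Rightarrow> (real^3 \<Rightarrow> real^3 \<Rightarrow> real^2) \<Rightarrow> real^3 \<Rightarrow> (real^3) set" where
  "hom_kernel D \<phi> p = {v \<in> D p. \<phi> p v = 0}"

definition singular_set ::
    "(real^3) set \<Rightarrow> (real^3 \<Rightarrow> (real^3) set) \<Rightarrow> (real^3 \<Rightarrow> real^3 \<Rightarrow> real^2) \<Rightarrow> (real^3) set" where
  "singular_set W D \<phi> = {p \<in> W. hom_rank D \<phi> p < 2}"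

definition corank_one_singular ::
    "(real^3) set \<Rightarrow> (real^3 \<Rightarrow> (real^3) set) \<Rightarrow> (real^3 \<Rightarrow> real^3 \<Rightarrow> real^2) \<Rightarrow> real^3 \<Rightarrow> bool" where
  "corank_one_singular W D \<phi> p \<longleftrightarrow> p \<in> singular_set W D \<phi> \<and> hom_rank D \<phi> p = 1"

text \<open>
  The determinant of the matrix with columns \<open>\<phi>(e\<^sub>1), \<phi>(e\<^sub>2)\<close>; for \<open>\<phi> = df\<close> this is
  \<open>det(e\<^sub>1f, e\<^sub>2f)\<close>.
\<close>

definition hom_det ::
    "(real^3 \<Rightarrow> real^3 \<Rightarrow> real^2) \<Rightarrow> (real^3 \<Rightarrow> real^3) \<Rightarrow> (real^3 \<Rightarrow> real^3) \<Rightarrow> real^3 \<Rightarrow> real" where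
  "hom_det \<phi> e1 e2 q = det (transpose (vector [\<phi> q (e1 q), \<phi> q (e2 q)] :: real^2^2))"

definition null_section_on ::
    "(real^3) set \<Rightarrow> (real^3 \<Rightarrow> (real^3) set) \<Rightarrow> (real^3 \<Rightarrow> real^3 \<Rightarrow> real^2) \<Rightarrow>
     (real^3) set \<Rightarrow> (real^3 \<Rightarrow> real^3) \<Rightarrow> bool" where
  "null_section_on W D \<phi> U \<eta> \<longleftrightarrow>
     U \<subseteq> W \<and> smooth_on U \<eta> \<and> (\<forall>q\<in>U. \<eta> q \<in> D q) \<and>
     (\<forall>q \<in> singular_set W D \<phi> \<inter> U. span {\<eta> q} = hom_kernel D \<phi> q)"

text \<open>
  The condition \<open>\<eta>\<lambda>(p) \<noteq> 0\<close> does not depend on the frame and the null section. The definition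
  asks for it for all choices, and also for some choice, so that it cannot hold vacuously.
\<close>

definition fold_like ::
    "(real^3) set \<Rightarrow> (real^3 \<Rightarrow> (real^3) set) \<Rightarrow> (real^3 \<Rightarrow> real^3 \<Rightarrow> real^2) \<Rightarrow> real^3 \<Rightarrow> bool" where
  "fold_like W D \<phi> p \<longleftrightarrow>
     corank_one_singular W D \<phi> p \<and>
     (\<exists>U e1 e2 \<eta>. open U \<and> p \<in> U \<and> frame_on U D e1 e2 \<and> null_section_on W D \<phi> U \<eta> \<and>
        frechet_derivative (hom_det \<phi> e1 e2) (at p) (\<eta> p) \<noteq> 0) \<and>
     (\<forall>U e1 e2 \<eta>. open U \<and> p \<in> U \<and> frame_on U D e1 e2 \<and> null_section_on W D \<phi> U \<eta> \<longrightarrow>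
        frechet_derivative (hom_det \<phi> e1 e2) (at p) (\<eta> p) \<noteq> 0)"

end

theory Submission
  imports Defs
begin

text \<open>
  Write \<open>\<tau> \<circ> f = g \<circ> \<sigma>\<close> with \<open>g\<close> the fold model. Then \<open>det(d\<tau>) \<lambda> = \<mu>\<close>, where \<open>\<mu>\<close> is the
  determinant of \<open>dg\<close> on the transported frame \<open>E\<^sub>j = d\<sigma>(e\<^sub>j)\<close>. Since \<open>\<lambda>(0) = 0\<close>, differentiating
  along a kernel vector \<open>\<eta>\<close> at \<open>0\<close> gives \<open>det(d\<tau>\<^sub>0) \<eta>\<lambda> = \<eta>\<mu>\<close>, so it suffices that \<open>\<eta>\<mu> \<noteq> 0\<close>.
  The second row of \<open>dg\<close> vanishes at \<open>0\<close>, so \<open>\<eta>\<mu>\<close> only involves its derivative, the Hessian of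
  \<open>v\<^sup>2 + w\<^sup>2\<close>, evaluated at \<open>d\<sigma>(\<eta>)\<close>; definiteness of this Hessian on the kernel of \<open>dg\<^sub>0\<close> makes
  it nonzero.

  A null section exists because some component \<open>i\<close> of \<open>(e\<^sub>1f, e\<^sub>2f)\<close> is nonzero near \<open>0\<close>:
  the \<open>i\<close>-th component of \<open>df(\<eta>)\<close> for \<open>\<eta> = - (e\<^sub>2f)\<^sub>i e\<^sub>1 + (e\<^sub>1f)\<^sub>i e\<^sub>2\<close> is \<open>0\<close> and the other one is
  \<open>\<plusminus>\<lambda>\<close>.
\<close>

section \<open>Smooth maps\<close>

lemma Ck_on_subset:
  assumes "Ck_on k U f" and "V \<subseteq> U"
  shows "Ck_on k V f"
  using assms by (induction k arbitrary: f) (auto intro: continuous_on_subset)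

text \<open>The base case is continuity of differentiable maps. Inductions over the product rule
  need this drop in class, since it pairs derivatives with undifferentiated factors.\<close>

lemma Ck_on_Suc_imp:
  assumes "Ck_on (Suc k) U f"
  shows "Ck_on k U f"
  using assms
proof (induction k arbitrary: f)
  case 0
  then show ?case
    by (auto intro!: continuous_at_imp_continuous_on differentiable_imp_continuous_within)
next
  case (Suc k)
  then show ?case by (metis Ck_on.simps(2))
qed

text \<open>A derivative at a point of an open set only sees values inside it, so agreement of the
  maps passes to their derivatives and hence to all orders.\<close>

lemma Ck_on_cong:
  assumes "open U" and "\<And>x. x \<in> U \<Longrightarrow> f x = g x" and "Ck_on k U f"
  shows "Ck_on k U g"
  using assms(2,3)
proof (induction k arbitrary: f g)
  case 0
  then show ?case by (metis Ck_on.simps(1) continuous_on_cong)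
next
  case (Suc k)
  have d: "(g has_derivative frechet_derivative f (at x)) (at x)" if "x \<in> U" for x
  proof (rule has_derivative_transform_within_open[OF _ assms(1) that])
    show "(f has_derivative frechet_derivative f (at x)) (at x)"
      using Suc.prems(2) that by (simp add: frechet_derivative_works[symmetric])
  qed (use Suc.prems(1) in auto)
  have "Ck_on k U (\<lambda>x. frechet_derivative g (at x) v)" for v
  proof (rule Suc.IH)
    show "frechet_derivative f (at x) v = frechet_derivative g (at x) v" if "x \<in> U" for x
      using frechet_derivative_at[OF d[OF that]] by simp
  qed (use Suc.prems(2) in auto)
  then show ?case using d by (auto simp: differentiable_def)
qed

text \<open>Uniqueness of derivatives lets an explicit formula stand in for the choice-based
  \<open>frechet_derivative\<close> of the recursion.\<close>

lemma Ck_on_SucI: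
  assumes "open U" and "\<And>x. x \<in> U \<Longrightarrow> (f has_derivative f' x) (at x)"
    and "\<And>v. Ck_on k U (\<lambda>x. f' x v)"
  shows "Ck_on (Suc k) U f"
proof -
  have "Ck_on k U (\<lambda>x. frechet_derivative f (at x) v)" for v
  proof (rule Ck_on_cong[OF assms(1) _ assms(3)])
    show "f' x v = frechet_derivative f (at x) v" if "x \<in> U" for x
      using frechet_derivative_at[OF assms(2)[OF that]] by simp
  qed
  then show ?thesis using assms(2) by (auto simp: differentiable_def)
qed

lemma Ck_on_has_derivative:
  assumes "Ck_on (Suc k) U f" and "x \<in> U"
  shows "(f has_derivative frechet_derivative f (at x)) (at x)"
  using assms by (simp add: frechet_derivative_works[symmetric])

lemma Ck_on_const:
  assumes "open U"
  shows "Ck_on k U (\<lambda>x. c)"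
proof (induction k arbitrary: c)
  case (Suc k)
  show ?case
    by (rule Ck_on_SucI[OF assms has_derivative_const Suc])
qed simp

lemma Ck_on_add:
  assumes "open U" and "Ck_on k U f" and "Ck_on k U g"
  shows "Ck_on k U (\<lambda>x. f x + g x)"
  using assms(2,3)
proof (induction k arbitrary: f g)
  case (Suc k)
  show ?case
  proof (rule Ck_on_SucI[OF assms(1)])
    show "((\<lambda>x. f x + g x) has_derivative
        (\<lambda>h. frechet_derivative f (at x) h + frechet_derivative g (at x) h)) (at x)"
      if "x \<in> U" for x
      using Suc.prems that by (intro has_derivative_add Ck_on_has_derivative)
  qed (use Suc in auto)
qed (auto intro: continuous_intros)

text \<open>Both terms of the product rule are again \<open>op\<close> applied to a pair of C^k
  maps, so one induction serves scalar multiples, linear maps and determinants.\<close>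

lemma Ck_on_bilinear:
  assumes "bounded_bilinear op" and "open U" and "Ck_on k U f" and "Ck_on k U g"
  shows "Ck_on k U (\<lambda>x. op (f x) (g x))"
  using assms(3,4)
proof (induction k arbitrary: f g)
  case 0
  then show ?case by (simp add: bounded_bilinear.continuous_on[OF assms(1)])
next
  case (Suc k)
  show ?case
  proof (rule Ck_on_SucI[OF assms(2)])
    show "((\<lambda>x. op (f x) (g x)) has_derivative
        (\<lambda>h. op (f x) (frechet_derivative g (at x) h) + op (frechet_derivative f (at x) h) (g x))) (at x)"
      if "x \<in> U" for x
      using Suc.prems that
      by (intro bounded_bilinear.FDERIV[OF assms(1)] Ck_on_has_derivative)
    show "Ck_on k U (\<lambda>x. op (f x) (frechet_derivative g (at x) v)
        + op (frechet_derivative f (at x) v) (g x))" for v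
      using Suc.prems
      by (intro Ck_on_add[OF assms(2)] Suc.IH Ck_on_Suc_imp[of k U f] Ck_on_Suc_imp[of k U g])
         simp_all
  qed
qed

lemma Ck_on_linear:
  assumes "bounded_linear l" and "open U" and "Ck_on k U f"
  shows "Ck_on k U (\<lambda>x. l (f x))"
proof -
  \<comment> \<open>A linear map is the bilinear map in a scalar and a vector, taken at the constant
    scalar 1.\<close>
  have "bounded_bilinear (\<lambda>(r::real) x. r *\<^sub>R l x)"
    using bounded_bilinear.comp[OF bounded_bilinear_scaleR bounded_linear_ident assms(1)] .
  from Ck_on_bilinear[OF this assms(2) Ck_on_const[OF assms(2)] assms(3), of 1]
  show ?thesis by simp
qed

section \<open>Closure properties of smooth maps\<close>

lemma smooth_on_subset: "smooth_on U f \<Longrightarrow> V \<subseteq> U \<Longrightarrow> smooth_on V f"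
  by (auto simp: smooth_on_def intro: Ck_on_subset)

lemma smooth_on_cong:
  "open U \<Longrightarrow> (\<And>x. x \<in> U \<Longrightarrow> f x = g x) \<Longrightarrow> smooth_on U f \<Longrightarrow> smooth_on U g"
  unfolding smooth_on_def using Ck_on_cong by blast

lemma smooth_on_add:
  "open U \<Longrightarrow> smooth_on U f \<Longrightarrow> smooth_on U g \<Longrightarrow> smooth_on U (\<lambda>x. f x + g x)"
  by (simp add: smooth_on_def Ck_on_add)

lemma smooth_on_sum:
  assumes "open U" and "\<And>i. i \<in> I \<Longrightarrow> smooth_on U (f i)"
  shows "smooth_on U (\<lambda>x. \<Sum>i\<in>I. f i x)"
proof -
  have *: "smooth_on U (\<lambda>x. 0)" by (simp add: smooth_on_def Ck_on_const[OF assms(1)])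
  show ?thesis
    using assms(2)
    by (induction I rule: infinite_finite_induct) (simp_all add: * smooth_on_add[OF assms(1)])
qed

lemma smooth_on_scaleR:
  "open U \<Longrightarrow> smooth_on U f \<Longrightarrow> smooth_on U g \<Longrightarrow> smooth_on U (\<lambda>x. f x *\<^sub>R g x)"
  by (simp add: smooth_on_def Ck_on_bilinear[OF bounded_bilinear_scaleR])

lemma smooth_on_linear:
  "bounded_linear l \<Longrightarrow> open U \<Longrightarrow> smooth_on U f \<Longrightarrow> smooth_on U (\<lambda>x. l (f x))"
  by (simp add: smooth_on_def Ck_on_linear)

lemma smooth_on_has_derivative:
  assumes "smooth_on U f" and "x \<in> U"
  shows "(f has_derivative frechet_derivative f (at x)) (at x)"
  using assms(1)[unfolded smooth_on_def, rule_format, of "Suc 0"] assms(2)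
  by (rule Ck_on_has_derivative)

text \<open>\<open>Ck_on\<close> controls derivatives in constant directions only. Expanding the
  moving direction \<open>e x\<close> in the standard basis leaves a finite sum of products of
  smooth maps.\<close>

lemma smooth_on_frechet_apply:
  assumes "open U" and "smooth_on U f" and "smooth_on U e"
  shows "smooth_on U (\<lambda>x. frechet_derivative f (at x) (e x))"
proof (rule smooth_on_cong[OF assms(1)])
  show "smooth_on U (\<lambda>x. \<Sum>b\<in>Basis. (e x \<bullet> b) *\<^sub>R frechet_derivative f (at x) b)"
  proof (intro smooth_on_sum smooth_on_scaleR assms(1))
    show "smooth_on U (\<lambda>x. frechet_derivative f (at x) b)" for b
      unfolding smooth_on_def
    proof
      show "Ck_on k U (\<lambda>x. frechet_derivative f (at x) b)" for k
        using assms(2)[unfolded smooth_on_def, rule_format, of "Suc k"] by simp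
    qed
    show "smooth_on U (\<lambda>x. e x \<bullet> b)" for b
      by (rule smooth_on_linear[OF bounded_linear_inner_left assms(1,3)])
  qed
  show "(\<Sum>b\<in>Basis. (e x \<bullet> b) *\<^sub>R frechet_derivative f (at x) b) = frechet_derivative f (at x) (e x)"
    if "x \<in> U" for x
  proof -
    have "linear (frechet_derivative f (at x))"
      using smooth_on_has_derivative[OF assms(2) that] has_derivative_linear by blast
    note lin = linear_sum[OF this] linear_cmul[OF this]
    have "frechet_derivative f (at x) (\<Sum>b\<in>Basis. (e x \<bullet> b) *\<^sub>R b) =
        (\<Sum>b\<in>Basis. (e x \<bullet> b) *\<^sub>R frechet_derivative f (at x) b)"
      by (simp only: lin)
    then show ?thesis by (simp add: euclidean_representation)
  qed
qed

section \<open>Planar determinants\<close>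

text \<open>The determinant as a bilinear form in two columns, to which the product rule applies
  directly.\<close>

definition det2 :: "real^2 \<Rightarrow> real^2 \<Rightarrow> real" where
  "det2 u v = u $ 1 * v $ 2 - u $ 2 * v $ 1"

lemma hom_det_eq_det2: "hom_det \<phi> e1 e2 q = det2 (\<phi> q (e1 q)) (\<phi> q (e2 q))"
  by (simp add: hom_det_def det2_def det_2 transpose_def)

lemma vec2_eq_sum_axis: "(u::real^2) = u $ 1 *\<^sub>R axis 1 1 + u $ 2 *\<^sub>R axis 2 1"
  by (simp add: vec_eq_iff forall_2 axis_def)

lemma bounded_bilinear_det2: "bounded_bilinear det2"
  unfolding bilinear_conv_bounded_bilinear[symmetric] bilinear_def
  by (auto simp: linear_iff det2_def algebra_simps)

lemma smooth_on_det2: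
  "open U \<Longrightarrow> smooth_on U f \<Longrightarrow> smooth_on U g \<Longrightarrow> smooth_on U (\<lambda>x. det2 (f x) (g x))"
  by (simp add: smooth_on_def Ck_on_bilinear[OF bounded_bilinear_det2])

text \<open>Multiplicativity of determinants: the factor in front is the determinant of
  \<open>A\<close>.\<close>

lemma det2_linear_image:
  assumes "linear A"
  shows "det2 (A u) (A v) = det2 (A (axis 1 1)) (A (axis 2 1)) * det2 u v"
proof -
  have *: "A w $ i = w $ 1 * A (axis 1 1) $ i + w $ 2 * A (axis 2 1) $ i" for w i
  proof -
    have "A w = A (w $ 1 *\<^sub>R axis 1 1 + w $ 2 *\<^sub>R axis 2 1)"
      using vec2_eq_sum_axis[of w] by (rule arg_cong)
    also have "\<dots> = w $ 1 *\<^sub>R A (axis 1 1) + w $ 2 *\<^sub>R A (axis 2 1)"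
      by (simp add: linear_add[OF assms] linear_cmul[OF assms])
    finally show ?thesis by simp
  qed
  show ?thesis
    unfolding det2_def *[of u] *[of v] by (simp add: algebra_simps)
qed

lemma dim_pair_less_2_iff: "dim {u, v} < 2 \<longleftrightarrow> det2 u v = 0"
proof
  assume d: "dim {u, v} < 2"
  show "det2 u v = 0"
  proof (rule ccontr)
    assume nz: "det2 u v \<noteq> 0"
    have uv: "u \<noteq> v" using nz by (auto simp: det2_def)
    have "independent {u, v}"
    proof -
      have "v \<noteq> 0" using nz by (auto simp: det2_def)
      moreover have "u \<notin> span {v}"
        using nz by (auto simp: span_singleton det2_def)
      ultimately show ?thesis by (simp add: independent_insert uv)
    qed
    then have "dim {u, v} = card {u, v}" by (rule dim_eq_card_independent)
    with uv d show False by simp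
  qed
next
  assume z: "det2 u v = 0"
  have "\<exists>w. {u, v} \<subseteq> span {w}"
  proof (cases "u = 0")
    case True
    then show ?thesis by (auto intro: exI[of _ v] span_base span_zero)
  next
    case False
    then obtain i where i: "u $ i \<noteq> 0" by (metis vec_eq_iff zero_index)
    \<comment> \<open>The ratio fits coordinate \<open>i\<close> by choice and the other coordinate
      because the determinant vanishes.\<close>
    have "(v $ i / u $ i) *\<^sub>R u = v"
      using z i exhaust_2[of i]
      by (auto simp: vec_eq_iff forall_2 det2_def field_simps)
    moreover have u: "u \<in> span {u}" by (simp add: span_base)
    ultimately have "v \<in> span {u}" using span_scale[OF u, of "v $ i / u $ i"] by simp
    with u show ?thesis by blast
  qed
  then obtain w where "{u, v} \<subseteq> span {w}" by blast
  then have "dim {u, v} \<le> card {w}" by (intro dim_le_card) auto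
  then show "dim {u, v} < 2" by simp
qed

text \<open>Parametrizes a line of solutions without knowing which coefficient is nonzero; used for
  kernels on a plane and for the fold form.\<close>

lemma solve_linear_pair:
  fixes a1 a2 \<alpha> \<beta> :: real
  assumes "\<alpha> * a1 + \<beta> * a2 = 0" and "a1 \<noteq> 0 \<or> a2 \<noteq> 0"
  obtains k where "\<alpha> = - k * a2" and "\<beta> = k * a1"
proof (cases "a1 = 0")
  case True
  then show ?thesis using assms that[of "- \<alpha> / a2"] by simp
next
  case False
  then show ?thesis using assms that[of "\<beta> / a1"] by (simp add: field_simps)
qed

section \<open>Linear maps on planes\<close>

lemma mem_span_pair: "x \<in> span {u, v} \<longleftrightarrow> (\<exists>\<alpha> \<beta>. x = \<alpha> *\<^sub>R u + \<beta> *\<^sub>R v)"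
proof -
  have "x \<in> span {u, v} \<longleftrightarrow> (\<exists>\<alpha> \<beta>. x - \<alpha> *\<^sub>R u = \<beta> *\<^sub>R v)"
    by (auto simp: span_insert span_singleton)
  then show ?thesis by (simp add: diff_eq_eq add.commute)
qed

lemma independent_pair_comb_eq_0:
  assumes "independent {u, v}" and "u \<noteq> v" and "\<alpha> *\<^sub>R u + \<beta> *\<^sub>R v = 0"
  shows "\<alpha> = 0 \<and> \<beta> = 0"
proof -
  have "(\<Sum>w\<in>{u, v}. (if w = u then \<alpha> else \<beta>) *\<^sub>R w) = 0"
    using assms(2,3) by simp
  note * = independentD[OF assms(1) _ subset_refl this]
  show ?thesis using *[of u] *[of v] assms(2) by simp
qed

text \<open>Row \<open>i\<close> of \<open>L\<close> is nonzero on the pair, so it alone confines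
  the kernel to the given line; the zero determinant makes the other row vanish on that line
  too.\<close>

lemma kernel_on_plane:
  assumes L: "linear (L :: 'a::euclidean_space \<Rightarrow> real^2)"
    and "det2 (L u) (L v) = 0" and i: "L u $ i \<noteq> 0 \<or> L v $ i \<noteq> 0"
  shows "{x \<in> span {u, v}. L x = 0} = span {(- (L v $ i)) *\<^sub>R u + (L u $ i) *\<^sub>R v}"
    (is "_ = span {?w}")
proof (intro equalityI subsetI)
  fix x assume x: "x \<in> {x \<in> span {u, v}. L x = 0}"
  then obtain \<alpha> \<beta> where x': "x = \<alpha> *\<^sub>R u + \<beta> *\<^sub>R v" by (auto simp: mem_span_pair)
  with x have "\<alpha> *\<^sub>R L u + \<beta> *\<^sub>R L v = 0"
    by (simp add: linear_add[OF L] linear_cmul[OF L])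
  then have "(\<alpha> *\<^sub>R L u + \<beta> *\<^sub>R L v) $ i = 0" by simp
  then have "\<alpha> * L u $ i + \<beta> * L v $ i = 0" by simp
  from solve_linear_pair[OF this i] obtain k where "\<alpha> = - k * L v $ i" "\<beta> = k * L u $ i" .
  then have "x = k *\<^sub>R ?w" by (simp add: x' algebra_simps)
  then show "x \<in> span {?w}" by (auto simp: span_singleton)
next
  fix x assume "x \<in> span {?w}"
  then obtain k where k: "x = k *\<^sub>R ?w" by (auto simp: span_singleton)
  have "L ?w = (- (L v $ i)) *\<^sub>R L u + (L u $ i) *\<^sub>R L v"
    by (simp only: linear_add[OF L] linear_cmul[OF L])
  \<comment> \<open>Component \<open>i\<close> cancels identically; the other one is the determinant
    up to sign.\<close>
  also have "\<dots> = 0"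
    using assms(2) exhaust_2[of i] by (auto simp: vec_eq_iff forall_2 det2_def algebra_simps)
  finally have "L x = 0" using k by (simp only: linear_cmul[OF L] scaleR_zero_right)
  moreover have "x \<in> span {u, v}"
    by (subst mem_span_pair) (metis k scaleR_right_distrib scaleR_scaleR)
  ultimately show "x \<in> {x \<in> span {u, v}. L x = 0}" by simp
qed

lemma dim_image_span_pair:
  assumes "linear L"
  shows "dim (L ` span {u, v}) = dim {L u, L v}"
proof -
  have "L ` span {u, v} = span {L u, L v}"
    using linear_span_image[OF assms, of "{u, v}"] by simp
  then show ?thesis by simp
qed

section \<open>Definite folds\<close>

lemma smooth_on_linear_derivative:
  assumes "smooth_on U f" and "x \<in> U"
  shows "linear (frechet_derivative f (at x))"
  using smooth_on_has_derivative[OF assms] by (rule has_derivative_linear)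

lemma smooth_on_tendsto:
  assumes "smooth_on U f" and "x \<in> U"
  shows "filterlim f (nhds (f x)) (nhds x)"
  using has_derivative_continuous[OF smooth_on_has_derivative[OF assms]]
  by (simp add: isCont_def tendsto_at_iff_tendsto_nhds)

text \<open>By the chain rule for \<open>\<sigma>' (\<sigma> x) = x\<close> near 0, the differential
  of \<open>\<sigma>'\<close> is a left inverse of that of \<open>\<sigma>\<close>.\<close>

lemma inverse_diffeo_germs_derivative_inj:
  assumes "inverse_diffeo_germs \<sigma> \<sigma>'" and "frechet_derivative \<sigma> (at 0) v = 0"
  shows "v = 0"
proof -
  obtain S S' where S: "0 \<in> S" "smooth_on S \<sigma>" "\<sigma> 0 = 0" and S': "0 \<in> S'" "smooth_on S' \<sigma>'"
    using assms(1) unfolding inverse_diffeo_germs_def smooth_map_germ_def by blast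
  obtain N where N: "open N" "0 \<in> N" "\<And>x. x \<in> N \<Longrightarrow> \<sigma>' (\<sigma> x) = x"
    using assms(1) unfolding inverse_diffeo_germs_def eventually_nhds by blast
  let ?A = "frechet_derivative \<sigma>' (at 0)"
  have "((\<lambda>x. \<sigma>' (\<sigma> x)) has_derivative (\<lambda>h. ?A (frechet_derivative \<sigma> (at 0) h))) (at 0)"
    using has_derivative_compose[OF smooth_on_has_derivative[OF S(2,1)], of \<sigma>' ?A]
      smooth_on_has_derivative[OF S'(2,1)] S(3) by simp
  from has_derivative_transform_within_open[OF this N(1,2)] N(3)
  have "((\<lambda>x. x) has_derivative (\<lambda>h. ?A (frechet_derivative \<sigma> (at 0) h))) (at 0)"
    by simp
  from has_derivative_unique[OF this has_derivative_ident]
  have "?A (frechet_derivative \<sigma> (at 0) v) = v" by metis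
  then show ?thesis
    using assms(2) linear_0[OF smooth_on_linear_derivative[OF S'(2,1)]] by simp
qed

section \<open>The fold model and its Hessian form\<close>

definition model_derivative :: "real^3 \<Rightarrow> real^3 \<Rightarrow> real^2" where
  "model_derivative x h = vector [h $ 1, 2 * x $ 2 * h $ 2 + 2 * x $ 3 * h $ 3]"

lemma definite_fold_model_has_derivative:
  "(definite_fold_model has_derivative model_derivative x) (at x)"
proof -
  have nth: "((\<lambda>y::real^3. y $ j) has_derivative (\<lambda>h. h $ j)) (at x)" for j
    by (rule bounded_linear_imp_has_derivative[OF bounded_linear_vec_nth])
  have *: "definite_fold_model =
      (\<lambda>y. (y $ 1) *\<^sub>R axis 1 1 + ((y $ 2)\<^sup>2 + (y $ 3)\<^sup>2) *\<^sub>R axis 2 1)"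
    by (auto simp: definite_fold_model_def fun_eq_iff vec_eq_iff forall_2 axis_def)
  show ?thesis
    unfolding *
    by (rule derivative_eq_intros nth refl)+
       (auto simp: model_derivative_def fun_eq_iff vec_eq_iff forall_2 axis_def)
qed

text \<open>
  With columns \<open>(a\<^sub>j, b\<^sub>j, c\<^sub>j)\<close>, the hypothesis says that \<open>(\<alpha>, \<beta>)\<close> is a multiple \<open>k\<close> of
  \<open>(-a\<^sub>2, a\<^sub>1)\<close>; the left-hand side is then \<open>k\<close> times a sum of two squares.
\<close>

lemma fold_form_nonzero:
  fixes E1 E2 :: "real^3" and \<alpha> \<beta> :: real
  defines "H \<equiv> \<alpha> *\<^sub>R E1 + \<beta> *\<^sub>R E2"
  assumes "H $ 1 = 0" and "H \<noteq> 0" and nz: "E1 $ 1 \<noteq> 0 \<or> E2 $ 1 \<noteq> 0"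
  shows "E1 $ 1 * (H $ 2 * E2 $ 2 + H $ 3 * E2 $ 3) - E2 $ 1 * (H $ 2 * E1 $ 2 + H $ 3 * E1 $ 3) \<noteq> 0"
proof -
  have "\<alpha> * E1 $ 1 + \<beta> * E2 $ 1 = 0" using assms(2) by (simp add: H_def)
  from solve_linear_pair[OF this nz] obtain k
    where k: "\<alpha> = - k * E2 $ 1" "\<beta> = k * E1 $ 1" .
  define Y where "Y = E1 $ 1 * E2 $ 2 - E2 $ 1 * E1 $ 2"
  define Z where "Z = E1 $ 1 * E2 $ 3 - E2 $ 1 * E1 $ 3"
  have H: "H $ 2 = k * Y" "H $ 3 = k * Z"
    by (simp_all add: H_def k Y_def Z_def algebra_simps)
  \<comment> \<open>As \<open>H $ 1 = 0\<close>, the vector \<open>H\<close> would be zero if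
    \<open>k\<close> vanished or both minors \<open>Y\<close> and \<open>Z\<close> did.\<close>
  with assms(2,3) have "k \<noteq> 0" "Y \<noteq> 0 \<or> Z \<noteq> 0"
    by (auto simp: vec_eq_iff forall_3)
  then have "k * (Y\<^sup>2 + Z\<^sup>2) \<noteq> 0" by (simp add: sum_power2_eq_zero_iff)
  moreover have "E1 $ 1 * (H $ 2 * E2 $ 2 + H $ 3 * E2 $ 3)
      - E2 $ 1 * (H $ 2 * E1 $ 2 + H $ 3 * E1 $ 3) = k * (Y\<^sup>2 + Z\<^sup>2)"
    unfolding H by (simp add: Y_def Z_def power2_eq_square algebra_simps)
  ultimately show ?thesis by simp
qed

section \<open>Transport of the determinant to the fold model\<close>

lemma definite_fold_derivative_equation:
  assumes "definite_fold f" and U: "open U" "0 \<in> U" "smooth_on U f" and "f 0 = 0"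
  obtains N T \<sigma> \<tau> where "open N" "0 \<in> N" "N \<subseteq> U" "smooth_on N \<sigma>" "\<sigma> 0 = 0"
    "open T" "smooth_on T \<tau>" "f ` N \<subseteq> T"
    "\<And>v. frechet_derivative \<sigma> (at 0) v = 0 \<Longrightarrow> v = 0"
    "\<And>v. frechet_derivative \<tau> (at 0) v = 0 \<Longrightarrow> v = 0"
    "\<And>q h. q \<in> N \<Longrightarrow> frechet_derivative \<tau> (at (f q)) (frechet_derivative f (at q) h) =
       model_derivative (\<sigma> q) (frechet_derivative \<sigma> (at q) h)"
proof -
  obtain \<sigma> \<sigma>' \<tau> where \<sigma>: "inverse_diffeo_germs \<sigma> \<sigma>'" and \<tau>: "diffeo_germ \<tau>"
    and eq: "\<forall>\<^sub>F x in nhds 0. \<tau> (f (\<sigma>' x)) = definite_fold_model x"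
    using assms(1) unfolding definite_fold_def A_equivalent_def by blast
  obtain \<tau>' where \<tau>': "inverse_diffeo_germs \<tau> \<tau>'" using \<tau> unfolding diffeo_germ_def by blast
  obtain S where S: "open S" "0 \<in> S" "smooth_on S \<sigma>" "\<sigma> 0 = 0"
    using \<sigma> unfolding inverse_diffeo_germs_def smooth_map_germ_def by blast
  obtain T where T: "open T" "0 \<in> T" "smooth_on T \<tau>"
    using \<tau>' unfolding inverse_diffeo_germs_def smooth_map_germ_def by blast
  \<comment> \<open>Substituting \<open>\<sigma> q\<close> for the model variable and cancelling
    \<open>\<sigma>'\<close> gives \<open>\<tau> (f q) = definite_fold_model (\<sigma> q)\<close>
    near 0.\<close>
  have "filterlim \<sigma> (nhds 0) (nhds 0)"
    using smooth_on_tendsto[OF S(3,2)] S(4) by simp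
  from eventually_compose_filterlim[OF eq this]
  have "\<forall>\<^sub>F q in nhds 0. \<tau> (f (\<sigma>' (\<sigma> q))) = definite_fold_model (\<sigma> q)" .
  moreover have "\<forall>\<^sub>F q in nhds 0. \<sigma>' (\<sigma> q) = q"
    using \<sigma> unfolding inverse_diffeo_germs_def by blast
  moreover have "\<forall>\<^sub>F q in nhds 0. f q \<in> T"
  proof -
    have "filterlim f (nhds 0) (nhds 0)"
      using smooth_on_tendsto[OF U(3,2)] assms(5) by simp
    from eventually_compose_filterlim[OF eventually_nhds_in_open[OF T(1,2)] this]
    show ?thesis .
  qed
  ultimately have "\<forall>\<^sub>F q in nhds 0. \<tau> (f q) = definite_fold_model (\<sigma> q) \<and> f q \<in> T"
    by eventually_elim simp
  then obtain M where M: "open M" "0 \<in> M"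
    "\<And>q. q \<in> M \<Longrightarrow> \<tau> (f q) = definite_fold_model (\<sigma> q)" "\<And>q. q \<in> M \<Longrightarrow> f q \<in> T"
    unfolding eventually_nhds by blast
  let ?N = "M \<inter> U \<inter> S"
  have N: "open ?N" using M(1) U(1) S(1) by blast
  show ?thesis
  proof (rule that[of ?N \<sigma> T \<tau>])
    show "smooth_on ?N \<sigma>" using S(3) by (rule smooth_on_subset) blast
    show "frechet_derivative \<tau> (at (f q)) (frechet_derivative f (at q) h) =
       model_derivative (\<sigma> q) (frechet_derivative \<sigma> (at q) h)" if q: "q \<in> ?N" for q h
    proof -
      have qs: "q \<in> U" "q \<in> S" "f q \<in> T" using q M(4) by auto
      note d = has_derivative_compose[OF smooth_on_has_derivative[OF U(3) qs(1)]
          smooth_on_has_derivative[OF T(3) qs(3)]]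
      \<comment> \<open>The identity is differentiated at every \<open>q\<close> near 0, because the
        resulting equation is differentiated once more at 0.\<close>
      have 1: "((\<lambda>q. definite_fold_model (\<sigma> q)) has_derivative
          (\<lambda>h. frechet_derivative \<tau> (at (f q)) (frechet_derivative f (at q) h))) (at q)"
        by (rule has_derivative_transform_within_open[OF d N q]) (rule M(3), blast)
      note 2 = has_derivative_compose[OF smooth_on_has_derivative[OF S(3) qs(2)]
          definite_fold_model_has_derivative]
      show ?thesis using fun_cong[OF has_derivative_unique[OF 1 2]] .
    qed
    show "f ` ?N \<subseteq> T" using M(4) by blast
    show "0 \<in> ?N" using M(2) U(2) S(2) by blast
    show "v = 0" if "frechet_derivative \<sigma> (at 0) v = 0" for v
      using inverse_diffeo_germs_derivative_inj[OF \<sigma> that] .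
    show "v = 0" if "frechet_derivative \<tau> (at 0) v = 0" for v
      using inverse_diffeo_germs_derivative_inj[OF \<tau>' that] .
  qed (use N S(4) T(1,3) in blast)+
qed

text \<open>At 0 the second entries vanish because \<open>\<sigma> 0 = 0\<close>, and so do their
  coefficients. Every term containing \<open>E1'\<close> or \<open>E2'\<close> therefore drops out,
  and only the derivative of these coefficients along \<open>\<sigma>'\<close> remains.\<close>

lemma model_det_has_derivative:
  fixes \<sigma> E1 E2 :: "real^3 \<Rightarrow> real^3"
  assumes "(\<sigma> has_derivative \<sigma>') (at 0)" and "\<sigma> 0 = 0"
    and "(E1 has_derivative E1') (at 0)" and "(E2 has_derivative E2') (at 0)"
  shows "((\<lambda>q. det2 (model_derivative (\<sigma> q) (E1 q)) (model_derivative (\<sigma> q) (E2 q))) has_derivative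
    (\<lambda>h. 2 * (E1 0 $ 1 * (\<sigma>' h $ 2 * E2 0 $ 2 + \<sigma>' h $ 3 * E2 0 $ 3)
            - E2 0 $ 1 * (\<sigma>' h $ 2 * E1 0 $ 2 + \<sigma>' h $ 3 * E1 0 $ 3)))) (at 0)"
proof -
  note nth = bounded_linear.has_derivative[OF bounded_linear_vec_nth]
  show ?thesis
    unfolding det2_def model_derivative_def vector_2
    by (rule derivative_eq_intros nth[OF assms(1)] nth[OF assms(3)] nth[OF assms(4)] refl)+
       (simp add: assms(2) fun_eq_iff algebra_simps)
qed

text \<open>Allowing any nonzero kernel vector \<open>v\<close> in the plane covers the value at 0
  of every null section.\<close>

lemma definite_fold_det_derivative_nonzero:
  assumes fold: "definite_fold f" and U: "open U" "0 \<in> U" "smooth_on U f" and f0: "f 0 = 0"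
    and e: "smooth_on U e1" "smooth_on U e2"
  defines "F \<equiv> \<lambda>q. frechet_derivative f (at q)"
  assumes sing: "det2 (F 0 (e1 0)) (F 0 (e2 0)) = 0"
    and rank: "F 0 (e1 0) \<noteq> 0 \<or> F 0 (e2 0) \<noteq> 0"
    and v: "v \<in> span {e1 0, e2 0}" "v \<noteq> 0" "F 0 v = 0"
  shows "frechet_derivative (\<lambda>q. det2 (F q (e1 q)) (F q (e2 q))) (at 0) v \<noteq> 0"
proof -
  obtain N T \<sigma> \<tau> where N: "open N" "0 \<in> N" "N \<subseteq> U" and \<sigma>: "smooth_on N \<sigma>" "\<sigma> 0 = 0"
    and T: "open T" "smooth_on T \<tau>" "f ` N \<subseteq> T"
    and inj_\<sigma>: "\<And>v. frechet_derivative \<sigma> (at 0) v = 0 \<Longrightarrow> v = 0"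
    and inj_\<tau>: "\<And>v. frechet_derivative \<tau> (at 0) v = 0 \<Longrightarrow> v = 0"
    and eq: "\<And>q h. q \<in> N \<Longrightarrow> frechet_derivative \<tau> (at (f q)) (F q h) =
       model_derivative (\<sigma> q) (frechet_derivative \<sigma> (at q) h)"
    using definite_fold_derivative_equation[OF fold U f0] unfolding F_def by metis
  define \<Lambda> where "\<Lambda> = (\<lambda>q. det2 (F q (e1 q)) (F q (e2 q)))"
  define E1 where "E1 = (\<lambda>q. frechet_derivative \<sigma> (at q) (e1 q))"
  define E2 where "E2 = (\<lambda>q. frechet_derivative \<sigma> (at q) (e2 q))"
  \<comment> \<open>\<open>c y\<close> is the determinant of the differential of
    \<open>\<tau>\<close> at \<open>y\<close>.\<close>
  define c where "c = (\<lambda>y. det2 (frechet_derivative \<tau> (at y) (axis 1 1))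
    (frechet_derivative \<tau> (at y) (axis 2 1)))"
  define H where "H = frechet_derivative \<sigma> (at 0) v"
  have eN: "smooth_on N e1" "smooth_on N e2" using e N(3) by (auto intro: smooth_on_subset)
  have "0 \<in> T" using T(3) N(2) f0 by (metis image_subset_iff)
  have const: "smooth_on V (\<lambda>x. w)" if "open V" for V :: "'a::euclidean_space set" and w :: "'b::euclidean_space"
    using that by (simp add: smooth_on_def Ck_on_const)
  have "smooth_on U \<Lambda>"
    unfolding \<Lambda>_def F_def by (intro smooth_on_det2 smooth_on_frechet_apply U e)
  then have d\<Lambda>: "(\<Lambda> has_derivative frechet_derivative \<Lambda> (at 0)) (at 0)"
    using U(2) by (rule smooth_on_has_derivative)
  have "smooth_on T c"
    unfolding c_def by (intro smooth_on_det2 smooth_on_frechet_apply T const)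
  then have "(c has_derivative frechet_derivative c (at 0)) (at (f 0))"
    using smooth_on_has_derivative[OF _ \<open>0 \<in> T\<close>] f0 by simp
  from has_derivative_compose[OF smooth_on_has_derivative[OF U(3,2)] this]
  have dc: "((\<lambda>q. c (f q)) has_derivative (\<lambda>h. frechet_derivative c (at 0) (F 0 h))) (at 0)"
    by (simp add: F_def)
  have prod_eq: "c (f q) * \<Lambda> q = det2 (model_derivative (\<sigma> q) (E1 q)) (model_derivative (\<sigma> q) (E2 q))"
    if "q \<in> N" for q
  proof -
    have "linear (frechet_derivative \<tau> (at (f q)))"
      using T(2,3) that by (intro smooth_on_linear_derivative) auto
    from det2_linear_image[OF this, of "F q (e1 q)" "F q (e2 q)"] show ?thesis
      by (simp add: c_def \<Lambda>_def E1_def E2_def eq[OF that])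
  qed
  \<comment> \<open>The other term of the product rule carries the factor
    \<open>\<Lambda> 0 = 0\<close>.\<close>
  have 1: "((\<lambda>q. c (f q) * \<Lambda> q) has_derivative
      (\<lambda>h. c (f 0) * frechet_derivative \<Lambda> (at 0) h)) (at 0)"
    using has_derivative_mult[OF dc d\<Lambda>] sing by (simp add: \<Lambda>_def)
  have "((\<lambda>q. det2 (model_derivative (\<sigma> q) (E1 q)) (model_derivative (\<sigma> q) (E2 q)))
      has_derivative (\<lambda>h. c (f 0) * frechet_derivative \<Lambda> (at 0) h)) (at 0)"
    by (rule has_derivative_transform_within_open[OF 1 N(1,2)]) (rule prod_eq)
  moreover have "((\<lambda>q. det2 (model_derivative (\<sigma> q) (E1 q)) (model_derivative (\<sigma> q) (E2 q)))
      has_derivative (\<lambda>h. 2 * (E1 0 $ 1 * (frechet_derivative \<sigma> (at 0) h $ 2 * E2 0 $ 2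
            + frechet_derivative \<sigma> (at 0) h $ 3 * E2 0 $ 3)
        - E2 0 $ 1 * (frechet_derivative \<sigma> (at 0) h $ 2 * E1 0 $ 2
            + frechet_derivative \<sigma> (at 0) h $ 3 * E1 0 $ 3)))) (at 0)"
  proof (rule model_det_has_derivative[OF smooth_on_has_derivative[OF \<sigma>(1) N(2)] \<sigma>(2)])
    show "(E1 has_derivative frechet_derivative E1 (at 0)) (at 0)"
      unfolding E1_def
      by (rule smooth_on_has_derivative[OF smooth_on_frechet_apply[OF N(1) \<sigma>(1) eN(1)] N(2)])
    show "(E2 has_derivative frechet_derivative E2 (at 0)) (at 0)"
      unfolding E2_def
      by (rule smooth_on_has_derivative[OF smooth_on_frechet_apply[OF N(1) \<sigma>(1) eN(2)] N(2)])
  qed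
  ultimately have key: "c (f 0) * frechet_derivative \<Lambda> (at 0) v =
      2 * (E1 0 $ 1 * (H $ 2 * E2 0 $ 2 + H $ 3 * E2 0 $ 3)
         - E2 0 $ 1 * (H $ 2 * E1 0 $ 2 + H $ 3 * E1 0 $ 3))"
    unfolding H_def by (rule fun_cong[OF has_derivative_unique])
  note lin\<sigma> = smooth_on_linear_derivative[OF \<sigma>(1) N(2)]
    and lin\<tau> = smooth_on_linear_derivative[OF T(2) \<open>0 \<in> T\<close>]
  obtain \<alpha> \<beta> where "v = \<alpha> *\<^sub>R e1 0 + \<beta> *\<^sub>R e2 0" using v(1) unfolding mem_span_pair by blast
  then have H: "H = \<alpha> *\<^sub>R E1 0 + \<beta> *\<^sub>R E2 0"
    by (simp add: H_def E1_def E2_def linear_add[OF lin\<sigma>] linear_cmul[OF lin\<sigma>])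
  have eq0: "frechet_derivative \<tau> (at 0) (F 0 h) =
      vector [frechet_derivative \<sigma> (at 0) h $ 1, 0]" for h
    using eq[OF N(2), of h] by (simp add: f0 \<sigma>(2) model_derivative_def)
  have "vector [H $ 1, 0] = (0 :: real^2)"
    using eq0[of v] v(3) linear_0[OF lin\<tau>] by (simp add: H_def)
  then have "H $ 1 = 0" by (metis vector_2(1) zero_index)
  moreover have "H \<noteq> 0" using inj_\<sigma> v(2) by (auto simp: H_def)
  moreover have "E1 0 $ 1 \<noteq> 0 \<or> E2 0 $ 1 \<noteq> 0"
  \<comment> \<open>The second entry in \<open>eq0\<close> is always 0. If both first entries
    vanished too, injectivity of the differential of \<open>\<tau>\<close> would make both images
    under \<open>F 0\<close> zero.\<close>
  proof (rule ccontr)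
    assume "\<not> ?thesis"
    moreover have "vector [0, 0] = (0 :: real^2)" by (simp add: vec_eq_iff forall_2)
    ultimately have "frechet_derivative \<tau> (at 0) (F 0 (e1 0)) = 0"
        "frechet_derivative \<tau> (at 0) (F 0 (e2 0)) = 0"
      using eq0 by (simp_all add: E1_def E2_def)
    then have "F 0 (e1 0) = 0" "F 0 (e2 0) = 0" using inj_\<tau> by blast+
    with rank show False by simp
  qed
  \<comment> \<open>By \<open>key\<close> the product is twice the fold form; a nonzero product has
    nonzero factors.\<close>
  ultimately have "c (f 0) * frechet_derivative \<Lambda> (at 0) v \<noteq> 0"
    using fold_form_nonzero[of \<alpha> "E1 0" \<beta> "E2 0", folded H] key by simp
  then show ?thesis by (simp add: \<Lambda>_def)
qed

section \<open>From the determinant to the bundle homomorphism\<close>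

theorem mainTheorem3:
  fixes f :: "real^3 \<Rightarrow> real^2"
    and W :: "(real^3) set"
    and D :: "real^3 \<Rightarrow> (real^3) set"
    and \<phi> :: "real^3 \<Rightarrow> real^3 \<Rightarrow> real^2"
  assumes "open W" and "0 \<in> W"
    and "smooth_on W f" and "f 0 = 0"
    and "definite_fold f"
    and "rank2_distribution_on W D"
    and "\<And>p v. p \<in> W \<Longrightarrow> v \<in> D p \<Longrightarrow> \<phi> p v = frechet_derivative f (at p) v"
    and "hom_rank D \<phi> 0 = 1"
  shows "fold_like W D \<phi> 0"
proof -
  let ?F = "\<lambda>q. frechet_derivative f (at q)"
  have F: "linear (?F q)" if "q \<in> W" for q
    using assms(3) that by (rule smooth_on_linear_derivative)
  \<comment> \<open>\<open>\<phi>\<close> agrees with the derivative of \<open>f\<close> only on the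
    planes of \<open>D\<close>, so rank and kernel are first rewritten in terms of that
    derivative.\<close>
  have rank: "hom_rank D \<phi> q = dim {?F q u, ?F q v}"
    if "q \<in> W" "D q = span {u, v}" for q u v
  proof -
    have "\<phi> q ` D q = ?F q ` span {u, v}"
      using assms(7)[OF that(1)] that(2) by (auto intro!: image_cong)
    then show ?thesis by (simp add: hom_rank_def dim_image_span_pair[OF F[OF that(1)]])
  qed
  have kernel: "hom_kernel D \<phi> q = {x \<in> span {u, v}. ?F q x = 0}"
    if "q \<in> W" "D q = span {u, v}" for q u v
    using assms(7)[OF that(1)] that(2) by (auto simp: hom_kernel_def)
  have at_0: "det2 (?F 0 u) (?F 0 v) = 0"
      "\<exists>i. ?F 0 u $ i \<noteq> 0 \<or> ?F 0 v $ i \<noteq> 0"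
    if "D 0 = span {u, v}" for u v
  proof -
    note * = rank[OF assms(2) that, unfolded assms(8)]
    then show "det2 (?F 0 u) (?F 0 v) = 0"
      unfolding dim_pair_less_2_iff[symmetric] by simp
    have "\<not> (?F 0 u = 0 \<and> ?F 0 v = 0)" using * by auto
    then show "\<exists>i. ?F 0 u $ i \<noteq> 0 \<or> ?F 0 v $ i \<noteq> 0" by (auto simp: vec_eq_iff)
  qed
  have corank: "corank_one_singular W D \<phi> 0"
    using assms(2,8) by (simp add: corank_one_singular_def singular_set_def)

  \<comment> \<open>This is the universal half of \<open>fold_like\<close>; applied to the null
    section built below, it also settles the existential half.\<close>
  have nonzero: "frechet_derivative (hom_det \<phi> e1 e2) (at 0) (\<eta> 0) \<noteq> 0"
    if U: "open U" "0 \<in> U" and fr: "frame_on U D e1 e2" and \<eta>: "null_section_on W D \<phi> U \<eta>"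
    for U e1 e2 \<eta>
  proof -
    have UW: "U \<subseteq> W" using \<eta> by (simp add: null_section_on_def)
    have e: "smooth_on U e1" "smooth_on U e2" using fr by (simp_all add: frame_on_def)
    have D: "D q = span {e1 q, e2 q}" if "q \<in> U" for q using fr that by (auto simp: frame_on_def)
    note D0 = D[OF U(2)]
    obtain i where i: "?F 0 (e1 0) $ i \<noteq> 0 \<or> ?F 0 (e2 0) $ i \<noteq> 0" using at_0(2)[OF D0] by blast
    let ?w = "(- (?F 0 (e2 0) $ i)) *\<^sub>R e1 0 + (?F 0 (e1 0) $ i) *\<^sub>R e2 0"
    have ker: "hom_kernel D \<phi> 0 = span {?w}"
      using kernel[OF assms(2) D0] kernel_on_plane[OF F[OF assms(2)] at_0(1)[OF D0] i] by simp
    \<comment> \<open>The coefficients of \<open>?w\<close> are not both zero and the frame is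
      independent, so the kernel is a genuine line and its generator \<open>\<eta> 0\<close> cannot
      vanish.\<close>
    have "?w \<noteq> 0"
      using independent_pair_comb_eq_0[of "e1 0" "e2 0" "- (?F 0 (e2 0) $ i)" "?F 0 (e1 0) $ i"]
        fr U(2) i by (auto simp: frame_on_def)
    moreover have span_\<eta>: "span {\<eta> 0} = hom_kernel D \<phi> 0"
      using \<eta> corank U(2) by (auto simp: null_section_on_def corank_one_singular_def)
    moreover have "?w \<in> span {\<eta> 0}"
      unfolding span_\<eta> ker by (simp only: span_base singletonI)
    ultimately have "\<eta> 0 \<noteq> 0"
      by (metis empty_iff insert_iff span_empty span_insert_0)
    moreover have "\<eta> 0 \<in> span {e1 0, e2 0}" "?F 0 (\<eta> 0) = 0"
      using span_\<eta> span_base[of "\<eta> 0" "{\<eta> 0}"] kernel[OF assms(2) D0] by auto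
    ultimately have nz: "frechet_derivative (\<lambda>q. det2 (?F q (e1 q)) (?F q (e2 q))) (at 0) (\<eta> 0) \<noteq> 0"
      using i by (intro definite_fold_det_derivative_nonzero[OF assms(5) U
            smooth_on_subset[OF assms(3) UW] assms(4) e at_0(1)[OF D0]]) auto
    have "smooth_on U (\<lambda>q. det2 (?F q (e1 q)) (?F q (e2 q)))"
      by (intro smooth_on_det2 smooth_on_frechet_apply smooth_on_subset[OF assms(3) UW] e U)
    note d = smooth_on_has_derivative[OF this U(2)]
    \<comment> \<open>Agreement on the open set \<open>U\<close> suffices to carry the derivative at
      0 over to \<open>hom_det\<close>.\<close>
    have "hom_det \<phi> e1 e2 q = det2 (?F q (e1 q)) (?F q (e2 q))" if "q \<in> U" for q
      using assms(7) UW D[OF that] that by (auto simp: hom_det_eq_det2 span_base)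
    then have "(hom_det \<phi> e1 e2 has_derivative
        frechet_derivative (\<lambda>q. det2 (?F q (e1 q)) (?F q (e2 q))) (at 0)) (at 0)"
      by (intro has_derivative_transform_within_open[OF d U]) simp
    from frechet_derivative_at[OF this] nz show ?thesis by simp
  qed

  obtain V e1 e2 where V: "open V" "0 \<in> V" "V \<subseteq> W" and fr: "frame_on V D e1 e2"
    using assms(2,6) unfolding rank2_distribution_on_def by blast
  have D: "D q = span {e1 q, e2 q}" if "q \<in> V" for q using fr that by (auto simp: frame_on_def)
  obtain i where i: "?F 0 (e1 0) $ i \<noteq> 0 \<or> ?F 0 (e2 0) $ i \<noteq> 0"
    using at_0(2)[OF D[OF V(2)]] by blast
  define a1 where "a1 = (\<lambda>q. ?F q (e1 q) $ i)"
  define a2 where "a2 = (\<lambda>q. ?F q (e2 q) $ i)"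
  have e: "smooth_on V e1" "smooth_on V e2" using fr by (simp_all add: frame_on_def)
  have sa: "smooth_on V a1" "smooth_on V a2"
    unfolding a1_def a2_def using V e
    by (auto intro!: smooth_on_linear[OF bounded_linear_vec_nth] smooth_on_frechet_apply
        intro: smooth_on_subset[OF assms(3)])
  \<comment> \<open>Shrinking to where row \<open>i\<close> is nonzero lets the same
    \<open>i\<close>, hence one formula for \<open>\<eta>\<close>, describe the kernel at all
    singular points of \<open>U\<close>.\<close>
  define U where "U = V \<inter> (a1 -` (- {0}) \<union> a2 -` (- {0}))"
  have cont: "continuous_on V a" if "smooth_on V a" for a :: "real^3 \<Rightarrow> real"
    using that[unfolded smooth_on_def, rule_format, of 0] by simp
  have U: "open U" "0 \<in> U" "U \<subseteq> V"
  proof -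
    have "open (V \<inter> a1 -` (- {0}))" "open (V \<inter> a2 -` (- {0}))"
      by (intro continuous_open_preimage cont sa V open_Compl closed_singleton)+
    then show "open U" unfolding U_def Int_Un_distrib by blast
    show "0 \<in> U" "U \<subseteq> V" using V(2) i by (auto simp: U_def a1_def a2_def)
  qed
  define \<eta> where "\<eta> = (\<lambda>q. (- a2 q) *\<^sub>R e1 q + a1 q *\<^sub>R e2 q)"
  have "frame_on U D e1 e2"
    using fr U(3) by (auto simp: frame_on_def intro: smooth_on_subset)
  moreover have "null_section_on W D \<phi> U \<eta>"
    unfolding null_section_on_def
  proof (intro conjI ballI)
    show "U \<subseteq> W" using U V by blast
    have "smooth_on V \<eta>"
      unfolding \<eta>_def using V(1) e sa
      by (intro smooth_on_add smooth_on_scaleR smooth_on_linear[OF bounded_linear_minus[OF bounded_linear_ident]])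
    then show "smooth_on U \<eta>" using U(3) by (rule smooth_on_subset)
    show "\<eta> q \<in> D q" if "q \<in> U" for q
    proof -
      have "q \<in> V" using that U(3) by blast
      then show ?thesis unfolding D[OF \<open>q \<in> V\<close>] mem_span_pair \<eta>_def by blast
    qed
    show "span {\<eta> q} = hom_kernel D \<phi> q" if "q \<in> singular_set W D \<phi> \<inter> U" for q
    proof -
      have q: "q \<in> W" "hom_rank D \<phi> q < 2" "q \<in> U" "q \<in> V"
        using that U(3) by (auto simp: singular_set_def)
      note Dq = D[OF q(4)]
      have "det2 (?F q (e1 q)) (?F q (e2 q)) = 0"
        using q(2) rank[OF q(1) Dq] by (simp add: dim_pair_less_2_iff)
      moreover have "?F q (e1 q) $ i \<noteq> 0 \<or> ?F q (e2 q) $ i \<noteq> 0"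
        using q(3) by (auto simp: U_def a1_def a2_def)
      ultimately show ?thesis
        using kernel_on_plane[OF F[OF q(1)]] kernel[OF q(1) Dq]
        by (simp add: \<eta>_def a1_def a2_def)
    qed
  qed
  ultimately show ?thesis
    unfolding fold_like_def using corank nonzero U(1,2) by blast
qed

end
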